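(* Let $S=\{x_1,x_2,\ldots,x_n\}$ be a set of distinct positive integers. If the GCD matrix $(S)$ is totally nonnegative, then $$\big([S](S)^{-1}\big)_{ij}=\begin{cases} -1 & \text{if } i=j\neq 1,n,\\[2pt] \dfrac{x_2}{(x_1,x_2)} & \text{if } i=2,\ j=1,\\[4pt] \dfrac{(x_i,x_n)}{(x_1,x_n)} & \text{if } i\neq 1,2,\ j=1,\\[4pt] \dfrac{x_{n-1}}{(x_{n-1},x_n)} & \text{if } i=n-1,\ j=n,\\[4pt] \dfrac{(x_1,x_i)}{(x_1,x_n)} & \text{if } i\neq n,n-1,\ j=n,\\[4pt] 0 & \text{otherwise,}\end{cases}$$ and $[S](S)^{-1}\in \mathbb{M}_n(\mathbb{Z})$; namely, $(S)\mid [S]$.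
   Context: For positive integers $x,y$, $(x,y)$ denotes their greatest common divisor and $[x,y]$ their least common multiple. For a set $S=\{x_1,\ldots,x_n\}$ of distinct positive integers (with the given indexing), the GCD matrix $(S)$ is the $n\times n$ matrix whose $(i,j)$ entry is $(x_i,x_j)$, and the LCM matrix $[S]$ is the $n\times n$ matrix whose $(i,j)$ entry is $[x_i,x_j]$. The matrix $(S)$ is always positive definite (Beslin and Ligh), so $(S)^{-1}$ exists. A real matrix is totally nonnegative if all of its minors are nonnegative. $\mathbb{M}_n(\mathbb{Z})$ is the ring of $n\times n$ integer matrices; for $A,B\in\mathbb{M}_n(\mathbb{Z})$, $A\mid B$ means that there exists $C\in\mathbb{M}_n(\mathbb{Z})$ with $B=AC$ or $B=CA$.
   Formalization: The entry formula is stated for n ≥ 2 only: for n = 1 it would give 0, while [S](S)^{-1} = (1), and x_2 and x_{n-1} do not exist. Integrality and (S) | [S] are stated for all n ≥ 1. *)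

theory Defs
  imports
    "Jordan_Normal_Form.Gauss_Jordan_Elimination"
    "Jordan_Normal_Form.DL_Submatrix"
    "Jordan_Normal_Form.Determinant"
begin

(* The indexed set {x_1, ..., x_n} is given by x :: nat => nat, used on {1..n} only.
   Matrix positions are 0-based, so position (i, j) belongs to x_(i+1) and x_(j+1). *)

definition gcd_mat :: "nat \<Rightarrow> (nat \<Rightarrow> nat) \<Rightarrow> int mat" where
  "gcd_mat n x = mat n n (\<lambda>(i, j). int (gcd (x (Suc i)) (x (Suc j))))"

definition lcm_mat :: "nat \<Rightarrow> (nat \<Rightarrow> nat) \<Rightarrow> int mat" where
  "lcm_mat n x = mat n n (\<lambda>(i, j). int (lcm (x (Suc i)) (x (Suc j))))"

definition totally_nonneg :: "real mat \<Rightarrow> bool" where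
  "totally_nonneg A \<longleftrightarrow>
     (\<forall>I J. I \<subseteq> {..<dim_row A} \<longrightarrow> J \<subseteq> {..<dim_col A} \<longrightarrow> card I = card J \<longrightarrow>
        0 \<le> det (submatrix A I J))"

definition int_mat_dvd :: "nat \<Rightarrow> int mat \<Rightarrow> int mat \<Rightarrow> bool" where
  "int_mat_dvd n A B \<longleftrightarrow> (\<exists>C \<in> carrier_mat n n. B = A * C \<or> B = C * A)"

(* [S] (S)^{-1} over the reals.  mat_inverse returns Some inverse on invertible matrices,
   and (S) is always invertible when x_1, ..., x_n are distinct and positive. *)
definition lcm_gcd_inv :: "nat \<Rightarrow> (nat \<Rightarrow> nat) \<Rightarrow> real mat" where
  "lcm_gcd_inv n x =
     map_mat real_of_int (lcm_mat n x) * the (mat_inverse (map_mat real_of_int (gcd_mat n x)))"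

end

theory Submission
  imports Defs "HOL-Number_Theory.Totient"
begin

text \<open>
  The minor of \<open>(S)\<close> on rows \<open>{i, j}\<close> and columns \<open>{j, k}\<close>, where \<open>i < j < k\<close>, gives
  \<open>(x\<^sub>i, x\<^sub>k) x\<^sub>j \<le> (x\<^sub>i, x\<^sub>j) (x\<^sub>j, x\<^sub>k)\<close>. The converse inequality always holds, because the least
  common multiple of \<open>(x\<^sub>i, x\<^sub>j)\<close> and \<open>(x\<^sub>j, x\<^sub>k)\<close> divides \<open>x\<^sub>j\<close>. So \<open>(S)\<close> satisfies
  \<open>(x\<^sub>i, x\<^sub>k) x\<^sub>j = (x\<^sub>i, x\<^sub>j) (x\<^sub>j, x\<^sub>k)\<close> for \<open>i \<le> j \<le> k\<close>, which makes row \<open>i\<close> of \<open>[S]\<close> the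
  combination of rows \<open>1\<close>, \<open>i\<close> and \<open>n\<close> of \<open>(S)\<close> with coefficients \<open>x\<^sub>i / (x\<^sub>1, x\<^sub>i)\<close>, \<open>-1\<close> and
  \<open>x\<^sub>i / (x\<^sub>i, x\<^sub>n)\<close> when \<open>1 < i < n\<close>; rows \<open>1\<close> and \<open>n\<close> of \<open>[S]\<close> are multiples of rows \<open>n\<close> and \<open>1\<close> of \<open>(S)\<close>.
\<close>

section \<open>Order-two minors and a GCD inequality\<close>

lemma det_2x2:
  assumes A: "(A :: 'a :: comm_ring_1 mat) \<in> carrier_mat 2 2"
  shows "det A = A $$ (0, 0) * A $$ (1, 1) - A $$ (0, 1) * A $$ (1, 0)"
proof -
  have "det (mat_delete A 0 j) = mat_delete A 0 j $$ (0, 0)" for j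
    by (rule det_single, insert A, auto simp: mat_delete_def)
  then show ?thesis
    using A by (simp add: laplace_expansion_row[OF A, of 0] cofactor_def mat_delete_def numeral_2_eq_2)
qed

lemma totally_nonneg_minor_2x2:
  assumes tn: "totally_nonneg A"
    and ij: "i < j" "j < dim_row A" and kl: "k < l" "l < dim_col A"
  shows "A $$ (i, l) * A $$ (j, k) \<le> A $$ (i, k) * A $$ (j, l)"
proof -
  let ?B = "submatrix A {i, j} {k, l}"
  have rows: "{a. a < dim_row A \<and> a \<in> {i, j}} = {i, j}"
    and cols: "{a. a < dim_col A \<and> a \<in> {k, l}} = {k, l}"
    using ij kl by auto
  have B: "?B \<in> carrier_mat 2 2"
    using ij(1) kl(1) by (intro carrier_matI) (simp_all only: dim_submatrix rows cols, simp_all)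
  \<comment> \<open>The position of a selected index inside \<open>submatrix\<close> is the number
    of selected indices below it; these four sets give positions 0 and 1.\<close>
  have pos: "{a \<in> {i, j}. a < i} = {}" "{a \<in> {i, j}. a < j} = {i}"
    "{a \<in> {k, l}. a < k} = {}" "{a \<in> {k, l}. a < l} = {k}"
    using ij(1) kl(1) by auto
  have ent: "?B $$ (0, 0) = A $$ (i, k)" "?B $$ (0, 1) = A $$ (i, l)"
    "?B $$ (1, 0) = A $$ (j, k)" "?B $$ (1, 1) = A $$ (j, l)"
    using submatrix_index_card[of i A k "{i, j}" "{k, l}"]
      submatrix_index_card[of i A l "{i, j}" "{k, l}"]
      submatrix_index_card[of j A k "{i, j}" "{k, l}"]
      submatrix_index_card[of j A l "{i, j}" "{k, l}"] ij kl
    unfolding pos by simp_all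
  have "0 \<le> det ?B"
    using tn ij kl unfolding totally_nonneg_def by auto
  then show ?thesis
    unfolding det_2x2[OF B] ent by simp
qed

text \<open>The product of the two factors is their GCD times their LCM; the former divides both
  \<open>a\<close> and \<open>c\<close>, the latter divides \<open>b\<close>.\<close>

lemma gcd_mult_gcd_le:
  fixes a b c :: nat
  assumes "0 < a" "0 < b"
  shows "gcd a b * gcd b c \<le> gcd a c * b"
proof -
  have "gcd a b * gcd b c = gcd (gcd a b) (gcd b c) * lcm (gcd a b) (gcd b c)"
    by (rule prod_gcd_lcm_nat)
  also have "\<dots> \<le> gcd a c * b"
  proof (rule mult_le_mono)
    show "gcd (gcd a b) (gcd b c) \<le> gcd a c"
      using assms by (intro dvd_imp_le) (auto intro: dvd_trans)
    show "lcm (gcd a b) (gcd b c) \<le> b"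
      using assms by (intro dvd_imp_le lcm_least) auto
  qed
  finally show ?thesis .
qed

section \<open>Nonsingularity of GCD matrices via their quadratic form\<close>

text \<open>Allowing any finite \<open>D\<close> that contains the divisors lets one index set serve
  all pairs, so that the sums can be interchanged.\<close>

lemma gcd_eq_sum_totient:
  assumes "finite D" "{d. d dvd gcd a b} \<subseteq> D"
  shows "gcd a b = (\<Sum>d\<in>D. if d dvd a \<and> d dvd b then totient d else 0)"
proof -
  have "gcd a b = (\<Sum>d | d dvd gcd a b. totient d)"
    by (rule totient_divisor_sum[symmetric])
  also have "\<dots> = (\<Sum>d\<in>D. if d dvd gcd a b then totient d else 0)"
    using assms by (simp add: sum.If_cases Int_absorb1)
  finally show ?thesis by simp
qed

text \<open>
  The quadratic form of a GCD matrix is diagonalised by Gauss' identity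
  \<open>m = (\<Sum>d | d dvd m. \<phi>(d))\<close>, and its diagonal coefficients \<open>\<phi>(d)\<close> are positive.
\<close>

lemma gcd_quadratic_form_eq_sum:
  fixes f :: "'a \<Rightarrow> nat" and v :: "'a \<Rightarrow> int"
  assumes "finite D" and D: "\<And>i. i \<in> A \<Longrightarrow> {d. d dvd f i} \<subseteq> D"
  shows "(\<Sum>i\<in>A. \<Sum>j\<in>A. v i * v j * int (gcd (f i) (f j))) =
    (\<Sum>d\<in>D. int (totient d) * (\<Sum>i\<in>A. if d dvd f i then v i else 0)\<^sup>2)"
proof -
  let ?w = "\<lambda>d i. if d dvd f i then v i else 0"
  have "v i * v j * int (gcd (f i) (f j)) = (\<Sum>d\<in>D. int (totient d) * (?w d i * ?w d j))"
    if "i \<in> A" for i j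
  proof -
    have "{d. d dvd gcd (f i) (f j)} \<subseteq> D"
      using D[OF that] by auto
    note gcd = gcd_eq_sum_totient[OF \<open>finite D\<close> this]
    show ?thesis
      unfolding gcd of_nat_sum sum_distrib_left
      by (intro sum.cong) auto
  qed
  then have "(\<Sum>i\<in>A. \<Sum>j\<in>A. v i * v j * int (gcd (f i) (f j))) =
      (\<Sum>i\<in>A. \<Sum>j\<in>A. \<Sum>d\<in>D. int (totient d) * (?w d i * ?w d j))"
    by (intro sum.cong) auto
  also have "\<dots> = (\<Sum>i\<in>A. \<Sum>d\<in>D. \<Sum>j\<in>A. int (totient d) * (?w d i * ?w d j))"
    by (intro sum.cong refl sum.swap)
  also have "\<dots> = (\<Sum>d\<in>D. \<Sum>i\<in>A. \<Sum>j\<in>A. int (totient d) * (?w d i * ?w d j))"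
    by (rule sum.swap)
  also have "\<dots> = (\<Sum>d\<in>D. int (totient d) * (\<Sum>i\<in>A. ?w d i)\<^sup>2)"
    by (simp only: power2_eq_square sum_product) (simp only: sum_distrib_left)
  finally show ?thesis .
qed

text \<open>A vanishing sum of positively weighted squares forces each \<open>u d\<close> to vanish.
  Choosing \<open>d\<close> as the largest \<open>f k\<close> with \<open>v k \<noteq> 0\<close>
  isolates \<open>v k\<close> in \<open>u d\<close>, a contradiction.\<close>

lemma gcd_quadratic_form_definite:
  fixes f :: "'a \<Rightarrow> nat" and v :: "'a \<Rightarrow> int"
  assumes A: "finite A" "inj_on f A" and pos: "\<And>i. i \<in> A \<Longrightarrow> 0 < f i"
    and zero: "(\<Sum>i\<in>A. \<Sum>j\<in>A. v i * v j * int (gcd (f i) (f j))) = 0"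
    and "i \<in> A"
  shows "v i = 0"
proof (rule ccontr)
  assume "v i \<noteq> 0"
  define D where "D = (\<Union>i\<in>A. {d. d dvd f i})"
  define u where "u d = (\<Sum>i\<in>A. if d dvd f i then v i else 0)" for d
  have "finite D"
    using A pos by (auto simp: D_def)
  \<comment> \<open>Each \<open>d\<close> divides a positive number and is therefore
    nonzero.\<close>
  have tot: "0 < totient d" if "d \<in> D" for d
    using that by (auto simp: D_def dest!: pos intro!: Nat.gr0I)
  have "(\<Sum>d\<in>D. int (totient d) * (u d)\<^sup>2) = 0"
    using zero gcd_quadratic_form_eq_sum[OF \<open>finite D\<close>, of A f v] by (auto simp: D_def u_def)
  then have u0: "u d = 0" if "d \<in> D" for d
    using that tot[OF that] \<open>finite D\<close> by (subst (asm) sum_nonneg_eq_0_iff) auto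
  let ?K = "{i \<in> A. v i \<noteq> 0}"
  have "finite ?K" "?K \<noteq> {}"
    using A \<open>i \<in> A\<close> \<open>v i \<noteq> 0\<close> by auto
  then have "Max (f ` ?K) \<in> f ` ?K"
    by (intro Max_in) auto
  then obtain k where k: "k \<in> ?K" and fk: "f k = Max (f ` ?K)"
    by fastforce
  have k_max: "f i \<le> f k" if "i \<in> ?K" for i
    unfolding fk using \<open>finite ?K\<close> that by (intro Max_ge) auto
  \<comment> \<open>A multiple \<open>f i\<close> of \<open>f k\<close> with
    \<open>v i \<noteq> 0\<close> equals \<open>f k\<close> by maximality, so \<open>i = k\<close>
    by injectivity.\<close>
  have "(if f k dvd f i then v i else 0) = (if i = k then v k else 0)" if "i \<in> A" for i
  proof (cases "f k dvd f i \<and> v i \<noteq> 0")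
    case True
    then have "f i = f k"
      using that k_max[of i] pos[OF that] by (auto dest!: dvd_imp_le)
    then show ?thesis
      using that k A(2) by (auto dest: inj_onD)
  next
    case False
    then show ?thesis
      using k by auto
  qed
  then have "u (f k) = v k"
    using k A(1) by (simp add: u_def)
  moreover have "f k \<in> D"
    using k by (auto simp: D_def intro!: bexI[of _ k])
  ultimately show False
    using k u0 by auto
qed

lemma det_gcd_mat_nonzero:
  assumes inj: "inj_on x {1..n}" and pos: "\<And>i. i \<in> {1..n} \<Longrightarrow> 0 < x i"
  shows "det (gcd_mat n x) \<noteq> 0"
proof
  have G: "gcd_mat n x \<in> carrier_mat n n"
    by (simp add: gcd_mat_def)
  assume "det (gcd_mat n x) = 0"
  \<comment> \<open>A singular matrix over an integral domain has a nonzero kernel vector over the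
    same domain, so \<open>v\<close> has integer entries.\<close>
  then obtain v where v: "v \<in> carrier_vec n" "v \<noteq> 0\<^sub>v n" and Gv: "gcd_mat n x *\<^sub>v v = 0\<^sub>v n"
    using det_0_iff_vec_prod_zero[OF G] by auto
  let ?f = "\<lambda>i. x (Suc i)"
  have "(\<Sum>j<n. int (gcd (?f i) (?f j)) * v $ j) = 0" if "i < n" for i
  proof -
    have "(gcd_mat n x *\<^sub>v v) $ i = 0"
      unfolding Gv using that by simp
    then show ?thesis
      using that v by (simp add: gcd_mat_def scalar_prod_def lessThan_atLeast0)
  qed
  then have "(\<Sum>i<n. v $ i * (\<Sum>j<n. int (gcd (?f i) (?f j)) * v $ j)) = 0"
    by simp
  then have zero: "(\<Sum>i<n. \<Sum>j<n. v $ i * v $ j * int (gcd (?f i) (?f j))) = 0"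
    by (simp add: sum_distrib_left mult_ac)
  have inj': "inj_on ?f {..<n}"
    by (rule inj_onI) (use inj_onD[OF inj] in force)
  have "v $ i = 0" if "i < n" for i
    by (rule gcd_quadratic_form_definite[where f = ?f and v = "\<lambda>i. v $ i", OF finite_lessThan inj' _ zero])
      (use that in \<open>simp_all add: pos\<close>)
  then have "v = 0\<^sub>v n"
    using v by (intro eq_vecI) auto
  with v show False by simp
qed

section \<open>Multiplicativity of GCDs under total nonnegativity\<close>

lemma totally_nonneg_gcd_mat_mult:
  assumes tn: "totally_nonneg (map_mat real_of_int (gcd_mat n x))"
    and pos: "\<And>i. i \<in> {1..n} \<Longrightarrow> 0 < x i"
    and ijk: "1 \<le> i" "i \<le> j" "j \<le> k" "k \<le> n"
  shows "gcd (x i) (x k) * x j = gcd (x i) (x j) * gcd (x j) (x k)"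
proof (cases "i = j \<or> j = k")
  case True
  then show ?thesis by auto
next
  case False
  let ?A = "map_mat real_of_int (gcd_mat n x)"
  have A: "?A $$ (a - 1, b - 1) = real (gcd (x a) (x b))"
    if "a \<in> {1..n}" "b \<in> {1..n}" for a b
    using that by (auto simp: gcd_mat_def)
  have "?A $$ (i - 1, k - 1) * ?A $$ (j - 1, j - 1) \<le> ?A $$ (i - 1, j - 1) * ?A $$ (j - 1, k - 1)"
    using False ijk by (intro totally_nonneg_minor_2x2[OF tn]) (auto simp: gcd_mat_def)
  then have "real (gcd (x i) (x k) * x j) \<le> real (gcd (x i) (x j) * gcd (x j) (x k))"
    using A[of i k] A[of j j] A[of i j] A[of j k] ijk by simp
  moreover have "gcd (x i) (x j) * gcd (x j) (x k) \<le> gcd (x i) (x k) * x j"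
    using pos ijk by (intro gcd_mult_gcd_le) auto
  ultimately show ?thesis
    by linarith
qed

text \<open>Both sides agree after multiplication by \<open>gcd a b\<close>. With
  \<open>x 1\<close>, \<open>x i\<close>, \<open>x j\<close> for \<open>a\<close>, \<open>b\<close>,
  \<open>c\<close>, scaling row 1 of the GCD matrix gives its row \<open>i\<close> from the diagonal
  on; with \<open>x n\<close> for \<open>a\<close>, row \<open>n\<close> does so up to the
  diagonal.\<close>

lemma div_gcd_mult_gcd:
  fixes a b c :: nat
  assumes "0 < b" and eq: "gcd a c * b = gcd a b * gcd b c"
  shows "b div gcd a b * gcd a c = gcd b c"
proof -
  have "gcd a b * (b div gcd a b * gcd a c) = gcd a b * (b div gcd a b) * gcd a c"
    by (rule mult.assoc[symmetric])
  also have "\<dots> = gcd a c * b"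
    by (simp only: dvd_mult_div_cancel[OF gcd_dvd2] mult.commute)
  finally have "gcd a b * (b div gcd a b * gcd a c) = gcd a b * gcd b c"
    unfolding eq .
  moreover have "gcd a b \<noteq> 0"
    using assms(1) by simp
  ultimately show ?thesis
    by (rule mult_left_cancel[THEN iffD1, rotated])
qed

text \<open>Multiplying by \<open>gcd a c * gcd a b\<close> reduces this to
  \<open>a * b = gcd a b * lcm a b\<close>. It shows that the other scaled end row supplies the LCM
  entries.\<close>

lemma div_gcd_mult_gcd_eq_lcm:
  fixes a b c :: nat
  assumes "0 < a" and eq: "gcd a c * b = gcd a b * gcd b c"
  shows "a div gcd a c * gcd b c = lcm a b"
proof -
  have "(gcd a c * gcd a b) * (a div gcd a c * gcd b c) =
      (gcd a c * (a div gcd a c)) * (gcd a b * gcd b c)"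
    by (simp only: ac_simps)
  also have "\<dots> = gcd a c * (a * b)"
    unfolding eq[symmetric] by (simp only: dvd_mult_div_cancel[OF gcd_dvd1] ac_simps)
  also have "\<dots> = (gcd a c * gcd a b) * lcm a b"
    unfolding prod_gcd_lcm_nat[of a b] by (rule mult.assoc[symmetric])
  finally have "(gcd a c * gcd a b) * (a div gcd a c * gcd b c) = (gcd a c * gcd a b) * lcm a b" .
  moreover have "gcd a c * gcd a b \<noteq> 0"
    using assms(1) by simp
  ultimately show ?thesis
    by (rule mult_left_cancel[THEN iffD1, rotated])
qed

section \<open>The integer quotient matrix\<close>

text \<open>Only meaningful for \<open>2 \<le> n\<close>: for \<open>n = 1\<close> it is the zero matrix, whereas \<open>[S](S)\<^sup>-\<^sup>1 = 1\<close>.\<close>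

definition lcm_gcd_quot :: "nat \<Rightarrow> (nat \<Rightarrow> nat) \<Rightarrow> int mat" where
  "lcm_gcd_quot n x = mat n n (\<lambda>(i, j).
     (if j = 0 then if i = 0 then 0 else int (x (Suc i) div gcd (x 1) (x (Suc i))) else 0) +
     (if j = n - 1 then if i = n - 1 then 0 else int (x (Suc i) div gcd (x (Suc i)) (x n)) else 0) +
     (if j = i then if i = 0 \<or> i = n - 1 then 0 else - 1 else 0))"

text \<open>On either side of the diagonal, one of \<open>p\<close>, \<open>q\<close> is the LCM and
  the other is the GCD, which the coefficient -1 cancels. For \<open>i = 1\<close> or
  \<open>i = n\<close> the GCD term and the -1 are both absent.\<close>

lemma lcm_eq_row_combination:
  assumes tn: "totally_nonneg (map_mat real_of_int (gcd_mat n x))"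
    and pos: "\<And>i. i \<in> {1..n} \<Longrightarrow> 0 < x i"
    and n: "2 \<le> n" and i: "i \<in> {1..n}" and j: "j \<in> {1..n}"
  shows "int (lcm (x i) (x j)) =
    (if i = 1 then 0 else int (x i div gcd (x 1) (x i))) * int (gcd (x 1) (x j)) +
    (if i = n then 0 else int (x i div gcd (x i) (x n))) * int (gcd (x n) (x j)) +
    (if i = 1 \<or> i = n then 0 else - 1) * int (gcd (x i) (x j))"
proof -
  note mult = totally_nonneg_gcd_mat_mult[OF tn pos]
  define p where "p = x i div gcd (x 1) (x i) * gcd (x 1) (x j)"
  define q where "q = x i div gcd (x i) (x n) * gcd (x n) (x j)"
  have le: "p = gcd (x i) (x j) \<and> q = lcm (x i) (x j)" if "i \<le> j"
  proof
    have "gcd (x 1) (x j) * x i = gcd (x 1) (x i) * gcd (x i) (x j)"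
      using that i j by (intro mult) auto
    from div_gcd_mult_gcd[OF pos[OF i] this] show "p = gcd (x i) (x j)"
      by (simp only: p_def)
    have "gcd (x i) (x n) * x j = gcd (x i) (x j) * gcd (x j) (x n)"
      using that i j by (intro mult) auto
    from div_gcd_mult_gcd_eq_lcm[OF pos[OF i] this] show "q = lcm (x i) (x j)"
      by (simp only: q_def gcd.commute[of "x n" "x j"])
  qed
  have ge: "p = lcm (x i) (x j) \<and> q = gcd (x i) (x j)" if "j \<le> i"
  proof
    have "gcd (x 1) (x i) * x j = gcd (x 1) (x j) * gcd (x j) (x i)"
      using that i j by (intro mult) auto
    then have "gcd (x i) (x 1) * x j = gcd (x i) (x j) * gcd (x j) (x 1)"
      by (simp only: ac_simps)
    from div_gcd_mult_gcd_eq_lcm[OF pos[OF i] this] show "p = lcm (x i) (x j)"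
      by (simp only: p_def gcd.commute[of "x 1" "x i"] gcd.commute[of "x 1" "x j"])
    have "gcd (x j) (x n) * x i = gcd (x j) (x i) * gcd (x i) (x n)"
      using that i j by (intro mult) auto
    then have "gcd (x n) (x j) * x i = gcd (x n) (x i) * gcd (x i) (x j)"
      by (simp only: ac_simps)
    from div_gcd_mult_gcd[OF pos[OF i] this] show "q = gcd (x i) (x j)"
      by (simp only: q_def gcd.commute[of "x i" "x n"])
  qed
  have "int (lcm (x i) (x j)) =
      (if i = 1 then 0 else int p) + (if i = n then 0 else int q) +
      (if i = 1 \<or> i = n then 0 else - 1) * int (gcd (x i) (x j))"
    using le ge n i j by (cases "i \<le> j") auto
  then show ?thesis
    by (simp add: p_def q_def)
qed

lemma lcm_gcd_quot_mult_gcd_mat: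
  assumes tn: "totally_nonneg (map_mat real_of_int (gcd_mat n x))"
    and pos: "\<And>i. i \<in> {1..n} \<Longrightarrow> 0 < x i"
    and n: "2 \<le> n"
  shows "lcm_gcd_quot n x * gcd_mat n x = lcm_mat n x"
proof (rule eq_matI)
  fix i j assume "i < dim_row (lcm_mat n x)" "j < dim_col (lcm_mat n x)"
  then have ij: "i < n" "j < n"
    by (simp_all add: lcm_mat_def)
  define a where "a = (if i = 0 then 0 else int (x (Suc i) div gcd (x 1) (x (Suc i))))"
  define b where "b = (if i = n - 1 then 0 else int (x (Suc i) div gcd (x (Suc i)) (x n)))"
  define c where "c = (if i = 0 \<or> i = n - 1 then 0 else - 1 :: int)"
  let ?g = "\<lambda>k. int (gcd (x (Suc k)) (x (Suc j)))"
  \<comment> \<open>Adding three one-point terms covers end rows too: where \<open>i\<close>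
    coincides with 0 or \<open>n - 1\<close>, \<open>c\<close> and the matching end coefficient are
    zero.\<close>
  have row: "lcm_gcd_quot n x $$ (i, k) =
      (if k = 0 then a else 0) + (if k = n - 1 then b else 0) + (if k = i then c else 0)" if "k < n" for k
    using that ij by (simp add: lcm_gcd_quot_def a_def b_def c_def)
  have "(lcm_gcd_quot n x * gcd_mat n x) $$ (i, j) = (\<Sum>k<n. lcm_gcd_quot n x $$ (i, k) * ?g k)"
    using ij by (simp add: lcm_gcd_quot_def gcd_mat_def scalar_prod_def lessThan_atLeast0)
  also have "\<dots> = (\<Sum>k<n. (if k = 0 then a * ?g k else 0) + (if k = n - 1 then b * ?g k else 0) +
      (if k = i then c * ?g k else 0))"
    by (intro sum.cong) (auto simp: row algebra_simps)
  also have "\<dots> = a * ?g 0 + b * ?g (n - 1) + c * ?g i"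
    using ij n by (simp add: sum.distrib)
  also have "\<dots> = lcm_mat n x $$ (i, j)"
    using lcm_eq_row_combination[OF tn pos n, of "Suc i" "Suc j"] ij n
    by (auto simp: lcm_mat_def a_def b_def c_def)
  finally show "(lcm_gcd_quot n x * gcd_mat n x) $$ (i, j) = lcm_mat n x $$ (i, j)" .
qed (simp_all add: lcm_gcd_quot_def gcd_mat_def lcm_mat_def)

section \<open>The real inverse and the closed form of the entries\<close>

lemma lcm_gcd_inv_eqI:
  assumes inj: "inj_on x {1..n}" and pos: "\<And>i. i \<in> {1..n} \<Longrightarrow> 0 < x i"
    and C: "C \<in> carrier_mat n n" "C * gcd_mat n x = lcm_mat n x"
  shows "lcm_gcd_inv n x = map_mat real_of_int C"
proof -
  let ?h = "map_mat real_of_int"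
  have G: "gcd_mat n x \<in> carrier_mat n n"
    by (simp add: gcd_mat_def)
  then have hG: "?h (gcd_mat n x) \<in> carrier_mat n n"
    by simp
  have "det (?h (gcd_mat n x)) \<noteq> 0"
    using det_gcd_mat_nonzero[OF inj pos] by (simp add: of_int_hom.hom_det)
  then have "?h (gcd_mat n x) \<in> Units (ring_mat TYPE(real) n ())"
    by (rule det_non_zero_imp_unit[OF hG])
  \<comment> \<open>\<open>mat_inverse\<close> yields \<open>None\<close> only on non-units, so
    \<open>the\<close> in \<open>lcm_gcd_inv\<close> extracts a genuine inverse.\<close>
  then obtain B where Some: "mat_inverse (?h (gcd_mat n x)) = Some B"
    using mat_inverse(1)[OF hG] by fastforce
  have B: "?h (gcd_mat n x) * B = 1\<^sub>m n" "B \<in> carrier_mat n n"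
    using mat_inverse(2)[OF hG Some] by auto
  have "lcm_gcd_inv n x = ?h (C * gcd_mat n x) * B"
    by (simp add: lcm_gcd_inv_def Some C)
  also have "\<dots> = ?h C * (?h (gcd_mat n x) * B)"
    using C(1) B(2) hG by (simp add: of_int_hom.mat_hom_mult[OF C(1) G])
  also have "\<dots> = ?h C"
    using C(1) by (simp add: B(1))
  finally show ?thesis .
qed

text \<open>Multiplicativity with \<open>x i\<close> between \<open>x 1\<close> and
  \<open>x n\<close> turns the stated end-column ratios into \<open>x i / gcd (x 1) (x i)\<close>
  and \<open>x i / gcd (x i) (x n)\<close>, so the separate cases 2 and \<open>n - 1\<close> merge
  with the general ones.\<close>

lemma lcm_gcd_quot_index:
  assumes tn: "totally_nonneg (map_mat real_of_int (gcd_mat n x))"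
    and pos: "\<And>i. i \<in> {1..n} \<Longrightarrow> 0 < x i"
    and n: "2 \<le> n" and i: "i \<in> {1..n}" and j: "j \<in> {1..n}"
  shows "real_of_int (lcm_gcd_quot n x $$ (i - 1, j - 1)) =
    (if i = j \<and> i \<noteq> 1 \<and> i \<noteq> n then - 1
     else if i = 2 \<and> j = 1 then real (x 2) / real (gcd (x 1) (x 2))
     else if i \<noteq> 1 \<and> i \<noteq> 2 \<and> j = 1 then real (gcd (x i) (x n)) / real (gcd (x 1) (x n))
     else if i = n - 1 \<and> j = n then real (x (n - 1)) / real (gcd (x (n - 1)) (x n))
     else if i \<noteq> n \<and> i \<noteq> n - 1 \<and> j = n then real (gcd (x 1) (x i)) / real (gcd (x 1) (x n))
     else 0)"
proof -
  have div: "real (a div gcd b a) = real a / real (gcd b a)"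
    "real (a div gcd a b) = real a / real (gcd a b)" for a b :: nat
    by (simp_all add: real_of_nat_div)
  have gpos: "gcd (x a) (x b) \<noteq> 0" if "a \<in> {1..n}" for a b
    using pos[OF that] by simp
  have "gcd (x 1) (x n) * x i = gcd (x 1) (x i) * gcd (x i) (x n)"
    using i by (intro totally_nonneg_gcd_mat_mult[OF tn pos]) auto
  then have "real (gcd (x 1) (x n)) * real (x i) = real (gcd (x 1) (x i)) * real (gcd (x i) (x n))"
    by (simp only: of_nat_mult[symmetric])
  then have first: "real (gcd (x i) (x n)) / real (gcd (x 1) (x n)) = real (x i) / real (gcd (x 1) (x i))"
    and last: "real (gcd (x 1) (x i)) / real (gcd (x 1) (x n)) = real (x i) / real (gcd (x i) (x n))"
    using gpos[of 1 n] gpos[of 1 i] gpos[of i n] i n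
    by (simp_all add: frac_eq_eq mult.commute del: gcd_eq_0_iff)
  have "lcm_gcd_quot n x $$ (i - 1, j - 1) =
    (if j = 1 then if i = 1 then 0 else int (x i div gcd (x 1) (x i)) else 0) +
    (if j = n then if i = n then 0 else int (x i div gcd (x i) (x n)) else 0) +
    (if j = i then if i = 1 \<or> i = n then 0 else - 1 else 0)"
    using i j n by (auto simp: lcm_gcd_quot_def)
  then show ?thesis
    unfolding first last using n by (auto simp: div)
qed

theorem theorem3p2:
  fixes n :: nat and x :: "nat \<Rightarrow> nat"
  assumes "1 \<le> n"
    and "inj_on x {1..n}"
    and "\<And>i. i \<in> {1..n} \<Longrightarrow> 0 < x i"
    and "totally_nonneg (map_mat real_of_int (gcd_mat n x))"
  shows "(2 \<le> n \<longrightarrow> (\<forall>i\<in>{1..n}. \<forall>j\<in>{1..n}.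
            lcm_gcd_inv n x $$ (i - 1, j - 1) =
              (if i = j \<and> i \<noteq> 1 \<and> i \<noteq> n then - 1
               else if i = 2 \<and> j = 1 then real (x 2) / real (gcd (x 1) (x 2))
               else if i \<noteq> 1 \<and> i \<noteq> 2 \<and> j = 1 then real (gcd (x i) (x n)) / real (gcd (x 1) (x n))
               else if i = n - 1 \<and> j = n then real (x (n - 1)) / real (gcd (x (n - 1)) (x n))
               else if i \<noteq> n \<and> i \<noteq> n - 1 \<and> j = n then real (gcd (x 1) (x i)) / real (gcd (x 1) (x n))
               else 0)))
         \<and> lcm_gcd_inv n x \<in> map_mat real_of_int ` carrier_mat n n
         \<and> int_mat_dvd n (gcd_mat n x) (lcm_mat n x)"
proof (cases "2 \<le> n")
  case True
  have C: "lcm_gcd_quot n x \<in> carrier_mat n n"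
    by (simp add: lcm_gcd_quot_def)
  have CG: "lcm_gcd_quot n x * gcd_mat n x = lcm_mat n x"
    using True by (intro lcm_gcd_quot_mult_gcd_mat assms)
  have inv: "lcm_gcd_inv n x = map_mat real_of_int (lcm_gcd_quot n x)"
    using C CG by (intro lcm_gcd_inv_eqI assms)
  have "lcm_gcd_inv n x $$ (i - 1, j - 1) = real_of_int (lcm_gcd_quot n x $$ (i - 1, j - 1))"
    if "i \<in> {1..n}" "j \<in> {1..n}" for i j
    unfolding inv using that C by (intro index_map_mat) auto
  moreover have "int_mat_dvd n (gcd_mat n x) (lcm_mat n x)"
    unfolding int_mat_dvd_def using C CG by metis
  moreover have "lcm_gcd_inv n x \<in> map_mat real_of_int ` carrier_mat n n"
    unfolding inv using C by (rule imageI)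
  ultimately show ?thesis
    using lcm_gcd_quot_index[OF assms(4,3) True] by simp
next
  case False
  with assms(1) have "n = 1"
    by simp
  \<comment> \<open>For \<open>n = 1\<close> both matrices have the single entry \<open>x 1\<close>,
    so the quotient is the identity.\<close>
  then have CG: "1\<^sub>m n * gcd_mat n x = lcm_mat n x"
    by (auto simp: gcd_mat_def lcm_mat_def)
  then have "lcm_gcd_inv n x = map_mat real_of_int (1\<^sub>m n)"
    by (intro lcm_gcd_inv_eqI assms) simp_all
  then have "lcm_gcd_inv n x \<in> map_mat real_of_int ` carrier_mat n n"
    by (simp only:) (intro imageI one_carrier_mat)
  moreover have "int_mat_dvd n (gcd_mat n x) (lcm_mat n x)"
    unfolding int_mat_dvd_def using CG by (metis one_carrier_mat)
  ultimately show ?thesis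
    using False by simp
qed

end
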